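(* Let $A$ be a locally Frobenius $k$-algebra of shape $\Lambda$. A non-trivial (i.e. non-zero) $A$-module which is finite dimensional over $k$ is not coherent.
   Context: $k$ is a field; all rings, algebras, modules and homomorphisms are unital. "$A$-module" means left or right $A$-module. Frobenius notions: a finite dimensional $k$-algebra $R$ is Frobenius if there is a linear form $\theta\colon R\to k$ (a Frobenius form) such that the bilinear form $(x,y)\mapsto\theta(xy)$ is nondegenerate; it is symmetric if $\theta$ can be chosen so that this bilinear form is symmetric. For a homomorphism of $k$-algebras $B\to C$, the extension $C:B$ is a Frobenius extension if there are a $B$-bimodule homomorphism $\Phi\colon C\to B$ and elements $x_i,y_i\in C$ ($1\le i\le n$) with $\sum_i y_i\Phi(x_ic)=c=\sum_i\Phi(cy_i)x_i$ for all $c\in C$; it is a free Frobenius extension if moreover $C$ is free as a left and as a right $B$-module. Shape: $(\Lambda,\preccurlyeq,\lambda_0)$ is an infinite partially ordered set such that any two elements have a common upper bound, $\lambda_0$ is a unique initial element, and for every $\lambda\in\Lambda$ there is $\lambda'\in\Lambda$ with $\lambda\preccurlyeq\lambda'$, $\lambda\ne\lambda'$. A (necessarily infinite dimensional) $k$-algebra $A$ is locally Frobenius of shape $\Lambda$ if: (a) there is a $\Lambda$-directed system of symmetric Frobenius $k$-algebras $A(\lambda)$ ($\lambda\in\Lambda$), augmented over $k$, with proper inclusion homomorphisms (of augmented algebras) $A(\lambda')\hookrightarrow A(\lambda'')$ for $\lambda'\preccurlyeq\lambda''$, $\lambda'\neq\lambda''$, with $A(\lambda_0)=k$ and $A=\bigcup_{\lambda\in\Lambda}A(\lambda)$;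 (b) each inclusion makes $A(\lambda''):A(\lambda')$ a free Frobenius extension. A module is pseudo-coherent if every finitely generated submodule is finitely presented, and coherent if it is finitely generated and pseudo-coherent. *)

theory Defs
  imports Complex_Main "HOL-Library.Function_Algebras"
begin

section \<open>Algebras over a field\<close>

locale k_algebra = vector_space scale
  for scale :: "'k::field \<Rightarrow> 'a::ring_1 \<Rightarrow> 'a" +
  assumes scale_mult_left: "scale c x * y = scale c (x * y)"
    and scale_mult_right: "x * scale c y = scale c (x * y)"

definition subalgebra :: "('k::field \<Rightarrow> 'a::ring_1 \<Rightarrow> 'a) \<Rightarrow> 'a set \<Rightarrow> bool" where
  "subalgebra scale R \<longleftrightarrow>
     module.subspace scale R \<and> 1 \<in> R \<and> (\<forall>x\<in>R. \<forall>y\<in>R. x * y \<in> R)"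

definition finite_dim :: "('k::field \<Rightarrow> 'v::ab_group_add \<Rightarrow> 'v) \<Rightarrow> 'v set \<Rightarrow> bool" where
  "finite_dim scale V \<longleftrightarrow> (\<exists>B. finite B \<and> module.span scale B = V)"

definition linear_form_on ::
  "('k::field \<Rightarrow> 'v::ab_group_add \<Rightarrow> 'v) \<Rightarrow> 'v set \<Rightarrow> ('v \<Rightarrow> 'k) \<Rightarrow> bool" where
  "linear_form_on scale V \<theta> \<longleftrightarrow>
     (\<forall>x\<in>V. \<forall>y\<in>V. \<theta> (x + y) = \<theta> x + \<theta> y) \<and> (\<forall>c. \<forall>x\<in>V. \<theta> (scale c x) = c * \<theta> x)"

definition augmentation ::
  "('k::field \<Rightarrow> 'a::ring_1 \<Rightarrow> 'a) \<Rightarrow> 'a set \<Rightarrow> ('a \<Rightarrow> 'k) \<Rightarrow> bool" where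
  "augmentation scale R \<epsilon> \<longleftrightarrow>
     linear_form_on scale R \<epsilon> \<and> \<epsilon> 1 = 1 \<and> (\<forall>x\<in>R. \<forall>y\<in>R. \<epsilon> (x * y) = \<epsilon> x * \<epsilon> y)"


section \<open>Frobenius algebras and Frobenius extensions\<close>

definition frobenius_form ::
  "('k::field \<Rightarrow> 'a::ring_1 \<Rightarrow> 'a) \<Rightarrow> 'a set \<Rightarrow> ('a \<Rightarrow> 'k) \<Rightarrow> bool" where
  "frobenius_form scale R \<theta> \<longleftrightarrow>
     linear_form_on scale R \<theta> \<and>
     (\<forall>x\<in>R. (\<forall>y\<in>R. \<theta> (x * y) = 0) \<longrightarrow> x = 0) \<and>
     (\<forall>y\<in>R. (\<forall>x\<in>R. \<theta> (x * y) = 0) \<longrightarrow> y = 0)"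

definition symmetric_frobenius ::
  "('k::field \<Rightarrow> 'a::ring_1 \<Rightarrow> 'a) \<Rightarrow> 'a set \<Rightarrow> bool" where
  "symmetric_frobenius scale R \<longleftrightarrow>
     finite_dim scale R \<and>
     (\<exists>\<theta>. frobenius_form scale R \<theta> \<and> (\<forall>x\<in>R. \<forall>y\<in>R. \<theta> (x * y) = \<theta> (y * x)))"

text \<open>Extensions are only needed for inclusions of subrings \<open>B \<subseteq> C\<close> of one ambient ring, so
  the structure homomorphism from \<open>B\<close> to \<open>C\<close> is the inclusion.\<close>

definition bimodule_hom_on :: "'a::ring_1 set \<Rightarrow> 'a set \<Rightarrow> ('a \<Rightarrow> 'a) \<Rightarrow> bool" where
  "bimodule_hom_on B C \<Phi> \<longleftrightarrow>
     (\<forall>c\<in>C. \<Phi> c \<in> B) \<and>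
     (\<forall>c\<in>C. \<forall>d\<in>C. \<Phi> (c + d) = \<Phi> c + \<Phi> d) \<and>
     (\<forall>b\<in>B. \<forall>c\<in>C. \<forall>b'\<in>B. \<Phi> (b * c * b') = b * \<Phi> c * b')"

definition frobenius_extension :: "'a::ring_1 set \<Rightarrow> 'a set \<Rightarrow> bool" where
  "frobenius_extension B C \<longleftrightarrow>
     (\<exists>\<Phi> (n::nat) x y. bimodule_hom_on B C \<Phi> \<and>
        (\<forall>i<n. x i \<in> C \<and> y i \<in> C) \<and>
        (\<forall>c\<in>C. (\<Sum>i<n. y i * \<Phi> (x i * c)) = c \<and> (\<Sum>i<n. \<Phi> (c * y i) * x i) = c))"

text \<open>\<open>C\<close> has a (possibly infinite) basis \<open>E\<close> over the scalars \<open>B\<close>: every element of \<open>C\<close> is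
  a finite \<open>B\<close>-linear combination of elements of \<open>E\<close> for a unique choice of coefficients.\<close>

definition free_over :: "('a \<Rightarrow> 'a \<Rightarrow> 'a) \<Rightarrow> 'a::ring_1 set \<Rightarrow> 'a set \<Rightarrow> bool" where
  "free_over act B C \<longleftrightarrow>
     (\<exists>E\<subseteq>C. \<forall>c\<in>C. \<exists>!f. range f \<subseteq> B \<and> {e. f e \<noteq> 0} \<subseteq> E \<and> finite {e. f e \<noteq> 0} \<and>
        c = (\<Sum>e | f e \<noteq> 0. act (f e) e))"

definition free_frobenius_extension :: "'a::ring_1 set \<Rightarrow> 'a set \<Rightarrow> bool" where
  "free_frobenius_extension B C \<longleftrightarrow>
     frobenius_extension B C \<and>
     free_over (\<lambda>b c. b * c) B C \<and>
     free_over (\<lambda>b c. c * b) B C"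


section \<open>Locally Frobenius algebras\<close>

locale shape =
  fixes lam0 :: "'l::order"
  assumes infinite_shape: "infinite (UNIV :: 'l set)"
    and directed: "\<exists>nu. lam \<le> nu \<and> mu \<le> (nu::'l)"
    and initial: "lam0 \<le> lam"
    and no_maximal: "\<exists>lam'. lam \<le> lam' \<and> lam \<noteq> (lam'::'l)"

locale locally_frobenius = k_algebra scale + shape lam0
  for scale :: "'k::field \<Rightarrow> 'a::ring_1 \<Rightarrow> 'a" and lam0 :: "'l::order" +
  fixes A :: "'l \<Rightarrow> 'a set"
    and eps :: "'l \<Rightarrow> 'a \<Rightarrow> 'k"
  assumes subalgebra: "subalgebra scale (A lam)"
    and symmetric_frobenius: "symmetric_frobenius scale (A lam)"
    and augmentation: "augmentation scale (A lam) (eps lam)"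
    and proper_inclusion: "lam \<le> mu \<Longrightarrow> lam \<noteq> mu \<Longrightarrow> A lam \<subset> A mu"
    and eps_inclusion: "lam \<le> mu \<Longrightarrow> x \<in> A lam \<Longrightarrow> eps mu x = eps lam x"
    and A_lam0: "A lam0 = range (\<lambda>c. scale c 1)"
    and A_union: "(\<Union>lam. A lam) = UNIV"
    and free_frobenius:
      "lam \<le> mu \<Longrightarrow> lam \<noteq> mu \<Longrightarrow> free_frobenius_extension (A lam) (A mu)"


section \<open>Modules\<close>

locale left_module =
  fixes act :: "'a::ring_1 \<Rightarrow> 'm::ab_group_add \<Rightarrow> 'm"
  assumes "act a (x + y) = act a x + act a y"
    and "act (a + b) x = act a x + act b x"
    and "act (a * b) x = act a (act b x)"
    and "act 1 x = x"

locale right_module =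
  fixes act :: "'m::ab_group_add \<Rightarrow> 'a::ring_1 \<Rightarrow> 'm"
  assumes "act (x + y) a = act x a + act y a"
    and "act x (a + b) = act x a + act x b"
    and "act x (a * b) = act (act x a) b"
    and "act x 1 = x"

text \<open>The following notions serve left and right modules at once. The action \<open>act\<close> is always
  written with the scalar first, and \<open>reg\<close> is the action of the ring on itself: \<open>a * x\<close> for left
  modules, \<open>x * a\<close> for right modules. Modules are given by carrier sets.\<close>

definition submodule :: "('a \<Rightarrow> 'm::ab_group_add \<Rightarrow> 'm) \<Rightarrow> 'm set \<Rightarrow> bool" where
  "submodule act N \<longleftrightarrow>
     0 \<in> N \<and> (\<forall>x\<in>N. \<forall>y\<in>N. x + y \<in> N) \<and> (\<forall>x\<in>N. - x \<in> N) \<and> (\<forall>a. \<forall>x\<in>N. act a x \<in> N)"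

definition finitely_generated :: "('a \<Rightarrow> 'm::ab_group_add \<Rightarrow> 'm) \<Rightarrow> 'm set \<Rightarrow> bool" where
  "finitely_generated act N \<longleftrightarrow> (\<exists>S. finite S \<and> submodule act hull S = N)"

definition module_hom_on ::
  "('a \<Rightarrow> 'm::ab_group_add \<Rightarrow> 'm) \<Rightarrow> ('a \<Rightarrow> 'n::ab_group_add \<Rightarrow> 'n) \<Rightarrow> 'm set \<Rightarrow> ('m \<Rightarrow> 'n) \<Rightarrow> bool"
  where
  "module_hom_on act act' M f \<longleftrightarrow>
     (\<forall>x\<in>M. \<forall>y\<in>M. f (x + y) = f x + f y) \<and> (\<forall>a. \<forall>x\<in>M. f (act a x) = act' a (f x))"

text \<open>The free module of rank \<open>n\<close>, as functions supported on \<open>{..<n}\<close>.\<close>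

definition free_module :: "nat \<Rightarrow> (nat \<Rightarrow> 'a::ring_1) set" where
  "free_module n = {v. \<forall>i\<ge>n. v i = 0}"

definition free_action :: "('a \<Rightarrow> 'a \<Rightarrow> 'a) \<Rightarrow> 'a \<Rightarrow> (nat \<Rightarrow> 'a) \<Rightarrow> (nat \<Rightarrow> 'a)" where
  "free_action reg a v = (\<lambda>i. reg a (v i))"

definition finitely_presented ::
  "('a \<Rightarrow> 'a \<Rightarrow> 'a) \<Rightarrow> ('a::ring_1 \<Rightarrow> 'm::ab_group_add \<Rightarrow> 'm) \<Rightarrow> 'm set \<Rightarrow> bool" where
  "finitely_presented reg act N \<longleftrightarrow>
     (\<exists>n f. module_hom_on (free_action reg) act (free_module n) f \<and>
        f ` free_module n = N \<and>
        finitely_generated (free_action reg) {v \<in> free_module n. f v = 0})"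

definition pseudo_coherent ::
  "('a \<Rightarrow> 'a \<Rightarrow> 'a) \<Rightarrow> ('a::ring_1 \<Rightarrow> 'm::ab_group_add \<Rightarrow> 'm) \<Rightarrow> 'm set \<Rightarrow> bool" where
  "pseudo_coherent reg act M \<longleftrightarrow>
     (\<forall>N\<subseteq>M. submodule act N \<and> finitely_generated act N \<longrightarrow> finitely_presented reg act N)"

definition coherent ::
  "('a \<Rightarrow> 'a \<Rightarrow> 'a) \<Rightarrow> ('a::ring_1 \<Rightarrow> 'm::ab_group_add \<Rightarrow> 'm) \<Rightarrow> 'm set \<Rightarrow> bool" where
  "coherent reg act M \<longleftrightarrow> finitely_generated act M \<and> pseudo_coherent reg act M"

definition left_coherent :: "('a::ring_1 \<Rightarrow> 'm::ab_group_add \<Rightarrow> 'm) \<Rightarrow> bool" where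
  "left_coherent act \<longleftrightarrow> coherent (\<lambda>a x. a * x) act UNIV"

definition right_coherent :: "('m::ab_group_add \<Rightarrow> 'a::ring_1 \<Rightarrow> 'm) \<Rightarrow> bool" where
  "right_coherent act \<longleftrightarrow> coherent (\<lambda>a x. x * a) (\<lambda>a x. act x a) UNIV"

end

theory Submission
  imports Defs
begin

text \<open>Suppose \<open>M = A\<^sup>n / K\<close> with \<open>K\<close> generated by finitely many vectors. These and a vector \<open>v \<notin> K\<close>
  have all entries in some \<open>A \<lambda>\<close>. Let \<open>E\<close> be a basis of \<open>A \<nu>\<close> over \<open>A \<lambda>\<close>, where \<open>\<lambda> < \<nu>\<close>. Freeness
  of the extensions \<open>A \<nu> \<subseteq> A \<rho>\<close> and \<open>A \<lambda> \<subseteq> A \<nu>\<close> lets one compare coefficients in a relation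
  \<open>(\<Sum>e. c\<^sub>e e) v \<in> K\<close>, which gives \<open>c\<^sub>e v \<in> K\<close> and hence \<open>c\<^sub>e = 0\<close>. So the images of the \<open>e v\<close> are
  linearly independent in \<open>M\<close>, and \<open>dim (A \<nu>) \<le> dim M * dim (A \<lambda>)\<close> for all \<open>\<nu>\<close>. But the
  dimensions of the \<open>A \<nu>\<close> are unbounded.\<close>

lemma sum_apply: "(\<Sum>i\<in>I. f i) x = (\<Sum>i\<in>I. f i x)"
  by (induction I rule: infinite_finite_induct) auto

lemma submodule_sum:
  assumes "submodule act N" "S \<subseteq> N"
  shows "(\<Sum>s\<in>S. act (a s) s) \<in> N"
  using assms(2)
proof (induction S rule: infinite_finite_induct)
  case (insert s S)
  then show ?case using assms(1) unfolding submodule_def by simp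
qed (use assms(1) in \<open>simp_all add: submodule_def\<close>)

text \<open>The multiplication \<open>mul\<close> stands for that of the ring or of its opposite, so that left and right
  modules are treated at once.\<close>

locale directed_free_algebra = vector_space scale
  for scale :: "'k::field \<Rightarrow> 'a::ring_1 \<Rightarrow> 'a" +
  fixes mul :: "'a \<Rightarrow> 'a \<Rightarrow> 'a" and A :: "'l::order \<Rightarrow> 'a set"
  assumes mul_add_left: "mul (x + y) z = mul x z + mul y z"
    and mul_add_right: "mul x (y + z) = mul x y + mul x z"
    and mul_assoc: "mul (mul x y) z = mul x (mul y z)"
    and mul_one_left: "mul 1 x = x"
    and mul_scale_left: "mul (scale c x) y = scale c (mul x y)"
    and mul_scale_right: "mul x (scale c y) = scale c (mul x y)"
    and subspace_A: "subspace (A lam)"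
    and one_A: "1 \<in> A lam"
    and mul_A: "x \<in> A lam \<Longrightarrow> y \<in> A lam \<Longrightarrow> mul x y \<in> A lam"
    and finite_dim_A: "finite_dim scale (A lam)"
    and A_strict_mono: "lam < mu \<Longrightarrow> A lam \<subset> A mu"
    and directed: "\<exists>nu. lam \<le> nu \<and> mu \<le> nu"
    and no_maximal: "\<exists>mu. lam < mu"
    and A_union: "(\<Union>lam. A lam) = UNIV"
    and free_A: "lam < mu \<Longrightarrow> free_over (\<lambda>b c. mul c b) (A lam) (A mu)"
begin

section \<open>Arithmetic of \<open>mul\<close> and exhaustion by the \<open>A lam\<close>\<close>

lemma mul_zero_left: "mul 0 x = 0"
  using mul_add_left[of 0 0 x] by simp

lemma mul_zero_right: "mul x 0 = 0"
  using mul_add_right[of x 0 0] by simp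

lemma mul_minus_left: "mul (- x) y = - mul x y"
  using mul_add_left[of x "- x" y] by (simp add: mul_zero_left eq_neg_iff_add_eq_0 add.commute)

lemma mul_diff_right: "mul x (y - z) = mul x y - mul x z"
  using mul_add_right[of x "y - z" z] by simp

lemma mul_sum_left: "mul (\<Sum>i\<in>I. f i) y = (\<Sum>i\<in>I. mul (f i) y)"
  by (induction I rule: infinite_finite_induct) (simp_all add: mul_zero_left mul_add_left)

lemma mul_sum_right: "mul x (\<Sum>i\<in>I. f i) = (\<Sum>i\<in>I. mul x (f i))"
  by (induction I rule: infinite_finite_induct) (simp_all add: mul_zero_right mul_add_right)

lemma A_mono: "lam \<le> mu \<Longrightarrow> A lam \<subseteq> A mu"
  using A_strict_mono[of lam mu] by (cases "lam = mu") (auto simp: less_le)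

lemma finite_subset_A:
  assumes "finite X"
  shows "\<exists>mu\<ge>lam. X \<subseteq> A mu"
  using assms
proof (induction X rule: finite_induct)
  case (insert x X)
  then obtain mu where mu: "lam \<le> mu" "X \<subseteq> A mu" by blast
  obtain mu' where "x \<in> A mu'" using A_union by blast
  moreover obtain nu where "mu \<le> nu" "mu' \<le> nu" using directed by blast
  ultimately show ?case using mu A_mono[of mu nu] A_mono[of mu' nu]
    by (intro exI[of _ nu]) auto
qed auto

text \<open>Because inclusions are proper, each step up the shape supplies a vector outside
  \<open>A mu\<close>, hence outside the span of the independent set found so far. Staying strictly
  above \<open>lam\<close> makes \<open>A mu\<close> free over \<open>A lam\<close>.\<close>

lemma unbounded_dim:
  "\<exists>mu B. lam < mu \<and> B \<subseteq> A mu \<and> finite B \<and> card B = m \<and> independent B"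
proof (induction m)
  case 0
  obtain mu where "lam < mu" using no_maximal by blast
  then show ?case by (intro exI[of _ mu] exI[of _ "{}"]) (auto simp: independent_empty)
next
  case (Suc m)
  then obtain mu B where B: "lam < mu" "B \<subseteq> A mu" "finite B" "card B = m" "independent B"
    by blast
  obtain nu where nu: "mu < nu" using no_maximal by blast
  then obtain x where x: "x \<in> A nu" "x \<notin> A mu" using A_strict_mono by blast
  have "x \<notin> span B" using span_minimal[OF B(2) subspace_A] x by blast
  then have "independent (insert x B)" "x \<notin> B"
    using B(5) span_base[of x B] independent_insertI by blast+
  then show ?case using B x nu A_strict_mono[OF nu]
    by (intro exI[of _ nu] exI[of _ "insert x B"]) auto
qed

section \<open>Bases over a subalgebra\<close>

text \<open>Uniqueness of coordinates is recast as independence. The set \<open>F\<close> may be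
  larger than the support, so that several expansions can be written over one common finite
  set.\<close>

definition basis_over :: "'a set \<Rightarrow> 'a set \<Rightarrow> 'a set \<Rightarrow> bool" where
  "basis_over B C E \<longleftrightarrow> E \<subseteq> C \<and>
     (\<forall>c\<in>C. \<exists>F f. finite F \<and> F \<subseteq> E \<and> (\<forall>e. f e \<in> B) \<and> (\<forall>e. e \<notin> F \<longrightarrow> f e = 0) \<and>
        c = (\<Sum>e\<in>F. mul e (f e))) \<and>
     (\<forall>F f. finite F \<and> F \<subseteq> E \<and> (\<forall>e\<in>F. f e \<in> B) \<and> (\<Sum>e\<in>F. mul e (f e)) = 0 \<longrightarrow> (\<forall>e\<in>F. f e = 0))"

lemma basis_over_subset: "basis_over B C E \<Longrightarrow> E \<subseteq> C"
  by (simp add: basis_over_def)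

lemma basis_over_expand:
  assumes "basis_over B C E" "c \<in> C"
  obtains F f where "finite F" "F \<subseteq> E" "\<And>e. f e \<in> B" "\<And>e. e \<notin> F \<Longrightarrow> f e = 0"
    "c = (\<Sum>e\<in>F. mul e (f e))"
  using assms unfolding basis_over_def by metis

lemma basis_over_independent:
  assumes "basis_over B C E" "finite F" "F \<subseteq> E" "\<And>e. e \<in> F \<Longrightarrow> f e \<in> B"
    "(\<Sum>e\<in>F. mul e (f e)) = 0" "e \<in> F"
  shows "f e = 0"
  using assms unfolding basis_over_def by blast

text \<open>Independence is uniqueness of the coordinates of 0: a relation, extended by zero, is an
  expansion of 0 and so agrees with the trivial one.\<close>

lemma ex_basis_over:
  assumes "lam < mu"
  obtains E where "basis_over (A lam) (A mu) E"
proof -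
  define coords where "coords E c f \<longleftrightarrow> range f \<subseteq> A lam \<and> {e. f e \<noteq> 0} \<subseteq> E \<and>
      finite {e. f e \<noteq> 0} \<and> c = (\<Sum>e | f e \<noteq> 0. mul e (f e))" for E c f
  have "\<exists>E\<subseteq>A mu. \<forall>c\<in>A mu. \<exists>!f. coords E c f"
    using free_A[OF assms] unfolding free_over_def coords_def .
  then obtain E where E: "E \<subseteq> A mu" and coords: "\<forall>c\<in>A mu. \<exists>!f. coords E c f"
    by (elim exE conjE)
  have ex: "\<exists>!f. coords E c f" if "c \<in> A mu" for c
    using coords that by (rule bspec)
  have "basis_over (A lam) (A mu) E"
    unfolding basis_over_def
  proof (intro conjI ballI allI impI)
    show "E \<subseteq> A mu" by fact
  next
    fix c assume "c \<in> A mu"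
    from ex1_implies_ex[OF ex[OF this]] obtain f where "coords E c f" ..
    then have f: "range f \<subseteq> A lam" "{e. f e \<noteq> 0} \<subseteq> E" "finite {e. f e \<noteq> 0}"
      "c = (\<Sum>e | f e \<noteq> 0. mul e (f e))" unfolding coords_def by blast+
    show "\<exists>F f. finite F \<and> F \<subseteq> E \<and> (\<forall>e. f e \<in> A lam) \<and> (\<forall>e. e \<notin> F \<longrightarrow> f e = 0) \<and>
        c = (\<Sum>e\<in>F. mul e (f e))"
      by (rule exI[of _ "{e. f e \<noteq> 0}"], rule exI[of _ f], intro conjI f(2,3,4))
        (use f(1) in auto)
  next
    fix F f e
    assume "finite F \<and> F \<subseteq> E \<and> (\<forall>e\<in>F. f e \<in> A lam) \<and> (\<Sum>e\<in>F. mul e (f e)) = 0" and e: "e \<in> F"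
    then have F: "finite F" "F \<subseteq> E" "\<forall>e\<in>F. f e \<in> A lam" "(\<Sum>e\<in>F. mul e (f e)) = 0" by auto
    \<comment> \<open>Coordinates in \<open>free_over\<close> are total functions with support in
      \<open>E\<close>, hence the extension of \<open>f\<close> by zero.\<close>
    define g where "g x = (if x \<in> F then f x else 0)" for x
    have sub: "{x. g x \<noteq> 0} \<subseteq> F" by (auto simp: g_def)
    have "(\<Sum>x | g x \<noteq> 0. mul x (g x)) = (\<Sum>x\<in>F. mul x (g x))"
      by (rule sum.mono_neutral_left) (use F sub in \<open>auto simp: mul_zero_right\<close>)
    also have "\<dots> = 0" using F(4) by (simp add: g_def)
    finally have g: "0 = (\<Sum>x | g x \<noteq> 0. mul x (g x))" by simp
    have 0: "0 \<in> A mu" "0 \<in> A lam" using subspace_0[OF subspace_A] by auto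
    have "range g \<subseteq> A lam" using F(3) 0(2) by (auto simp: g_def)
    then have "coords E 0 g"
      unfolding coords_def using F(2) sub g finite_subset[OF sub F(1)] by blast
    from the1_equality[where P = "coords E 0", OF ex[OF 0(1)] this]
    have g_eq: "(THE f. coords E 0 f) = g" .
    have zero: "coords E 0 (\<lambda>_. 0)"
      unfolding coords_def using 0(2) by auto
    from the1_equality[where P = "coords E 0", OF ex[OF 0(1)] zero]
    have "(THE f. coords E 0 f) = (\<lambda>_. 0)" .
    with g_eq have "g = (\<lambda>_. 0)" by simp
    then have "g e = 0" by simp
    then show "f e = 0" using e by (simp add: g_def)
  qed
  then show ?thesis using that by blast
qed

section \<open>Combinations of finitely many vectors\<close>

text \<open>For finite \<open>S\<close> and \<open>B = UNIV\<close> this contains the submodule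
  generated by \<open>S\<close>; smaller \<open>B\<close> records where the coefficients lie.
  Equality is stated entrywise because coordinates over a basis are compared in each entry.\<close>

definition combinations :: "'a set \<Rightarrow> (nat \<Rightarrow> 'a) set \<Rightarrow> (nat \<Rightarrow> 'a) set" where
  "combinations B S = {w. \<exists>a. (\<forall>s\<in>S. a s \<in> B) \<and> (\<forall>i. w i = (\<Sum>s\<in>S. mul (a s) (s i)))}"

lemma free_action_combinations:
  assumes "x \<in> A nu" "w \<in> combinations (A nu) S"
  shows "free_action mul x w \<in> combinations (A nu) S"
proof -
  obtain a where "\<forall>s\<in>S. a s \<in> A nu" "\<forall>i. w i = (\<Sum>s\<in>S. mul (a s) (s i))"
    using assms unfolding combinations_def by blast
  then show ?thesis
    using assms(1) unfolding combinations_def free_action_def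
    by (intro CollectI exI[of _ "\<lambda>s. mul x (a s)"]) (auto simp: mul_A mul_sum_right mul_assoc)
qed

lemma hull_subset_combinations:
  assumes "finite S"
  shows "submodule (free_action mul) hull S \<subseteq> combinations UNIV S"
proof (rule hull_minimal)
  show "S \<subseteq> combinations UNIV S"
  proof
    fix t assume t: "t \<in> S"
    \<comment> \<open>Indicator coefficients single out \<open>t\<close>; finiteness of
      \<open>S\<close> matters, as a sum over an infinite set is 0.\<close>
    have "(\<Sum>s\<in>S. mul (if s = t then 1 else 0) (s i)) = t i" for i
    proof -
      have "(\<Sum>s\<in>S. mul (if s = t then 1 else 0) (s i)) = (\<Sum>s\<in>S. if s = t then s i else 0)"
        by (rule sum.cong) (auto simp: mul_one_left mul_zero_left)
      then show ?thesis using t assms by simp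
    qed
    then show "t \<in> combinations UNIV S"
      unfolding combinations_def by (intro CollectI exI[of _ "\<lambda>s. if s = t then 1 else 0"]) auto
  qed
  show "submodule (free_action mul) (combinations UNIV S)"
    unfolding submodule_def
  proof (intro conjI ballI allI)
    show "0 \<in> combinations UNIV S"
      unfolding combinations_def
      by (intro CollectI exI[of _ "\<lambda>_. 0"]) (auto simp: mul_zero_left)
  next
    fix x y assume "x \<in> combinations UNIV S" "y \<in> combinations UNIV S"
    then obtain a b where "\<forall>i. x i = (\<Sum>s\<in>S. mul (a s) (s i))" "\<forall>i. y i = (\<Sum>s\<in>S. mul (b s) (s i))"
      unfolding combinations_def by blast
    then show "x + y \<in> combinations UNIV S"
      unfolding combinations_def
      by (intro CollectI exI[of _ "\<lambda>s. a s + b s"]) (auto simp: mul_add_left sum.distrib)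
  next
    fix x assume "x \<in> combinations UNIV S"
    then obtain a where "\<forall>i. x i = (\<Sum>s\<in>S. mul (a s) (s i))"
      unfolding combinations_def by blast
    then show "- x \<in> combinations UNIV S"
      unfolding combinations_def
      by (intro CollectI exI[of _ "\<lambda>s. - a s"]) (auto simp: mul_minus_left sum_negf)
  next
    fix c x assume "x \<in> combinations UNIV S"
    then obtain a where "\<forall>i. x i = (\<Sum>s\<in>S. mul (a s) (s i))"
      unfolding combinations_def by blast
    then show "free_action mul c x \<in> combinations UNIV S"
      unfolding combinations_def free_action_def
      by (intro CollectI exI[of _ "\<lambda>s. mul c (a s)"]) (auto simp: mul_sum_right mul_assoc)
  qed
qed

text \<open>The finitely many coefficients lie in a common member of the directed system. It is
  taken strictly above \<open>nu\<close> so that freeness over \<open>A nu\<close> applies.\<close>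

lemma combinations_UNIV_imp_A:
  assumes "finite S" "w \<in> combinations UNIV S"
  obtains rho where "nu < rho" "w \<in> combinations (A rho) S"
proof -
  obtain a where a: "\<forall>i. w i = (\<Sum>s\<in>S. mul (a s) (s i))"
    using assms unfolding combinations_def by blast
  obtain nu' where nu': "nu < nu'" using no_maximal by blast
  obtain rho where "rho \<ge> nu'" "a ` S \<subseteq> A rho"
    using finite_subset_A[of "a ` S" nu'] assms by blast
  then show ?thesis using a nu' that[of rho] unfolding combinations_def by fastforce
qed

text \<open>If \<open>C\<close> is free over \<open>B\<close> with basis \<open>E\<close> and \<open>S\<close> has entries in \<open>B\<close>, then \<open>CS\<close> is the direct sum of
  the \<open>e(BS)\<close> for \<open>e \<in> E\<close>.\<close>

lemma combinations_component:
  assumes E: "basis_over (A lam) C E"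
    and S: "finite S" "\<And>s i. s \<in> S \<Longrightarrow> s i \<in> A lam"
    and F: "finite F" "F \<subseteq> E"
    and w: "\<And>e i. e \<in> F \<Longrightarrow> w e i \<in> A lam"
    and comb: "(\<lambda>i. \<Sum>e\<in>F. mul e (w e i)) \<in> combinations C S"
    and e: "e \<in> F"
  shows "w e \<in> combinations (A lam) S"
proof -
  obtain a where a: "\<And>s. s \<in> S \<Longrightarrow> a s \<in> C"
    "\<And>i. (\<Sum>e\<in>F. mul e (w e i)) = (\<Sum>s\<in>S. mul (a s) (s i))"
    using comb unfolding combinations_def by blast
  define expands where "expands s G f \<longleftrightarrow> finite G \<and> G \<subseteq> E \<and> (\<forall>e. f e \<in> A lam) \<and>
      (\<forall>e. e \<notin> G \<longrightarrow> f e = 0) \<and> a s = (\<Sum>e\<in>G. mul e (f e))" for s G f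
  have "\<exists>G f. expands s G f" if s: "s \<in> S" for s
  proof -
    obtain G f where "finite G" "G \<subseteq> E" "\<And>e. f e \<in> A lam" "\<And>e. e \<notin> G \<Longrightarrow> f e = 0"
      "a s = (\<Sum>e\<in>G. mul e (f e))"
      using basis_over_expand[OF E a(1)[OF s]] by metis
    then have "expands s G f" by (simp add: expands_def)
    then show ?thesis by blast
  qed
  then obtain G f where "\<And>s. s \<in> S \<Longrightarrow> expands s (G s) (f s)" by metis
  then have G: "\<And>s. s \<in> S \<Longrightarrow> finite (G s)" "\<And>s. s \<in> S \<Longrightarrow> G s \<subseteq> E"
    and f: "\<And>s e. s \<in> S \<Longrightarrow> f s e \<in> A lam" "\<And>s e. s \<in> S \<Longrightarrow> e \<notin> G s \<Longrightarrow> f s e = 0"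
    and a_eq: "\<And>s. s \<in> S \<Longrightarrow> a s = (\<Sum>e\<in>G s. mul e (f s e))"
    unfolding expands_def by blast+
  \<comment> \<open>A common finite set of basis elements for the given sum and for the expansions
    of all coefficients \<open>a s\<close>.\<close>
  define H where "H = F \<union> (\<Union>s\<in>S. G s)"
  have H: "finite H" "H \<subseteq> E" using F S(1) G unfolding H_def by blast+
  define u where "u x i = (if x \<in> F then w x i else 0)" for x i
  \<comment> \<open>The \<open>x\<close>-coordinate of entry \<open>i\<close> of the combination, to
    be matched with \<open>u\<close>, the extension of \<open>w\<close> by zero.\<close>
  define z where "z x i = (\<Sum>s\<in>S. mul (f s x) (s i))" for x i
  have aH: "a s = (\<Sum>x\<in>H. mul x (f s x))" if "s \<in> S" for s
  proof -
    have "(\<Sum>x\<in>G s. mul x (f s x)) = (\<Sum>x\<in>H. mul x (f s x))"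
      by (rule sum.mono_neutral_left) (use H f that in \<open>auto simp: H_def mul_zero_right\<close>)
    then show ?thesis using a_eq[OF that] by simp
  qed
  have "u e i - z e i = 0" for i
  proof (rule basis_over_independent[OF E H, where f = "\<lambda>x. u x i - z x i"])
    fix x assume "x \<in> H"
    have "z x i \<in> A lam" unfolding z_def
      using S(2) f by (intro subspace_sum[OF subspace_A] mul_A) auto
    moreover have "u x i \<in> A lam" unfolding u_def using w subspace_0[OF subspace_A] by auto
    ultimately show "u x i - z x i \<in> A lam" by (intro subspace_diff[OF subspace_A])
  next
    have "(\<Sum>x\<in>H. mul x (u x i)) = (\<Sum>x\<in>F. mul x (u x i))"
      by (rule sum.mono_neutral_right) (use H in \<open>auto simp: H_def u_def mul_zero_right\<close>)
    also have "\<dots> = (\<Sum>x\<in>F. mul x (w x i))" by (simp add: u_def)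
    also have "\<dots> = (\<Sum>s\<in>S. mul (a s) (s i))" by (rule a(2))
    \<comment> \<open>As \<open>s i\<close> lies in \<open>A lam\<close>, regrouping by
      associativity again gives an expansion with coefficients in \<open>A lam\<close>.\<close>
    also have "\<dots> = (\<Sum>s\<in>S. \<Sum>x\<in>H. mul x (mul (f s x) (s i)))"
      by (intro sum.cong refl) (simp only: aH mul_sum_left mul_assoc)
    also have "\<dots> = (\<Sum>x\<in>H. mul x (z x i))"
      unfolding z_def mul_sum_right by (rule sum.swap)
    finally show "(\<Sum>x\<in>H. mul x (u x i - z x i)) = 0"
      by (simp add: mul_diff_right sum_subtractf)
  next
    show "e \<in> H" using e by (simp add: H_def)
  qed
  then have "w e i = (\<Sum>s\<in>S. mul (f s e) (s i))" for i
    using e by (simp add: u_def z_def)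
  then show ?thesis unfolding combinations_def using f
    by (intro CollectI exI[of _ "\<lambda>s. f s e"]) auto
qed

text \<open>A basis of \<open>A \<rho>\<close> over \<open>A \<nu>\<close> need not contain 1, so one multiplies \<open>w\<close> by a basis element first.\<close>

lemma combinations_descend:
  assumes S: "finite S" "\<And>s i. s \<in> S \<Longrightarrow> s i \<in> A nu"
    and w: "\<And>i. w i \<in> A nu" and comb: "w \<in> combinations UNIV S"
  shows "w \<in> combinations (A nu) S"
proof -
  obtain rho where rho: "nu < rho" "w \<in> combinations (A rho) S"
    using combinations_UNIV_imp_A[OF S(1) comb] by blast
  obtain E where E: "basis_over (A nu) (A rho) E" using ex_basis_over[OF rho(1)] .
  obtain F f where F: "F \<subseteq> E" "1 = (\<Sum>e\<in>F. mul e (f e))"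
    using basis_over_expand[OF E one_A] by metis
  \<comment> \<open>An empty \<open>F\<close> would give \<open>1 = 0\<close>.\<close>
  then obtain e where e: "e \<in> E" by force
  then have "free_action mul e w \<in> combinations (A rho) S"
    using basis_over_subset[OF E] rho(2) by (intro free_action_combinations) auto
  then have "(\<lambda>i. \<Sum>x\<in>{e}. mul x (w i)) \<in> combinations (A rho) S"
    by (simp add: free_action_def)
  then show ?thesis
    using combinations_component[of nu "A rho" E S "{e}" "\<lambda>_. w" e] E S w e by simp
qed

section \<open>Dimension count and the contradiction\<close>

text \<open>The products of elements of \<open>E\<close> with elements of \<open>T\<close> span
  \<open>A nu\<close> over the field.\<close>

lemma basis_over_span_bound:
  assumes E: "basis_over (A lam) (A nu) E" "finite E"
    and T: "finite T" "span T = A lam"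
    and B: "B \<subseteq> A nu" "independent B"
  shows "card B \<le> card E * card T"
proof -
  define P where "P = (\<lambda>(e, t). mul e t) ` (E \<times> T)"
  have P: "finite P" "card P \<le> card E * card T"
    unfolding P_def using E T card_image_le[of "E \<times> T"] by (auto simp: card_cartesian_product)
  have mul_span: "mul e b \<in> span P" if "e \<in> E" "b \<in> A lam" for e b
  proof -
    have "b \<in> span T" using that T by simp
    then show ?thesis
    proof (induction rule: span_induct_alt)
      case base
      then show ?case by (simp add: mul_zero_right span_zero)
    next
      case (step c t y)
      have "mul e t \<in> P" using \<open>e \<in> E\<close> step by (auto simp: P_def)
      then show ?case using step
        by (simp add: mul_add_right mul_scale_right span_add span_scale span_base)
    qed
  qed
  have "A nu \<subseteq> span P"
  proof
    fix x assume "x \<in> A nu"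
    then obtain F f where "F \<subseteq> E" "\<And>e. f e \<in> A lam" "x = (\<Sum>e\<in>F. mul e (f e))"
      using basis_over_expand[OF E(1)] by metis
    then show "x \<in> span P" by (auto intro!: span_sum mul_span)
  qed
  then have "card B \<le> card P"
    using independent_span_bound[OF P(1) B(2)] B(1) by blast
  then show ?thesis using P by simp
qed

theorem finite_dim_not_finitely_presented:
  fixes act :: "'a \<Rightarrow> 'm::ab_group_add \<Rightarrow> 'm"
  assumes act_add_right: "\<And>a x y. act a (x + y) = act a x + act a y"
    and act_add_left: "\<And>a b x. act (a + b) x = act a x + act b x"
    and act_mul: "\<And>a b x. act (mul a b) x = act a (act b x)"
    and act_one: "\<And>x. act 1 x = x"
    and nonzero: "\<exists>x::'m. x \<noteq> 0"
    and fin: "finite_dim (\<lambda>c x. act (scale c 1) x) (UNIV :: 'm set)"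
  shows "\<not> finitely_presented mul act (UNIV :: 'm set)"
proof
  assume "finitely_presented mul act (UNIV :: 'm set)"
  then obtain n f S where hom: "module_hom_on (free_action mul) act (free_module n) f"
    and im: "f ` free_module n = UNIV"
    and S: "finite S" and K: "submodule (free_action mul) hull S = {v \<in> free_module n. f v = 0}"
    unfolding finitely_presented_def finitely_generated_def by blast
  interpret M: vector_space "\<lambda>c x. act (scale c 1) x"
  proof (unfold_locales, goal_cases)
    case (1 a x y)
    then show ?case by (rule act_add_right)
  next
    case (2 a b x)
    then show ?case by (simp add: scale_left_distrib act_add_left)
  next
    case (3 a b x)
    then show ?case by (simp flip: act_mul add: mul_scale_left mul_one_left)
  next
    case (4 x)
    then show ?case by (simp add: act_one)
  qed
  interpret pair: vector_space_pair scale "\<lambda>c x. act (scale c 1) x" ..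
  obtain v where v: "v \<in> free_module n" "f v \<noteq> 0"
    using nonzero im by (metis UNIV_I imageE)
  have S_free: "S \<subseteq> free_module n" using hull_subset[of S "submodule (free_action mul)"] K by auto
  \<comment> \<open>Entries at positions from \<open>n\<close> on vanish, so finitely many entries
    determine \<open>v\<close> and the generators in \<open>S\<close>.\<close>
  define X where "X = (\<Union>s\<in>insert v S. s ` {..<n})"
  have "finite X" using S by (simp add: X_def)
  then obtain lam where lam: "X \<subseteq> A lam" using finite_subset_A by blast
  have entries: "s i \<in> A lam" if "s \<in> insert v S" for s i
  proof (cases "i < n")
    case True
    then show ?thesis using that lam by (auto simp: X_def)
  next
    case False
    then have "s i = 0" using that v(1) S_free by (auto simp: free_module_def)
    then show ?thesis using subspace_0[OF subspace_A] by simp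
  qed
  have f_act: "f (free_action mul x v) = act x (f v)" for x
    using hom v(1) by (simp add: module_hom_on_def)
  have act_eq_0: "free_action mul x v \<in> combinations UNIV S" if "act x (f v) = 0" for x
  proof -
    have "free_action mul x v \<in> free_module n"
      using v(1) by (auto simp: free_module_def free_action_def mul_zero_right)
    then have "free_action mul x v \<in> submodule (free_action mul) hull S"
      using K that f_act by auto
    then show ?thesis using hull_subset_combinations[OF S] by blast
  qed
  obtain T where T: "finite T" "M.span T = UNIV" using fin by (auto simp: finite_dim_def)
  obtain T' where T': "finite T'" "span T' = A lam"
    using finite_dim_A by (auto simp: finite_dim_def)
  \<comment> \<open>\<open>Suc\<close> puts \<open>card B\<close> one above the bound
    \<open>card T * card T'\<close> that is derived at the end.\<close>
  obtain nu B where nu: "lam < nu" and B: "B \<subseteq> A nu" "card B = Suc (card T * card T')" "independent B"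
    using unbounded_dim by blast
  obtain E where E: "basis_over (A lam) (A nu) E" using ex_basis_over[OF nu] .
  have scalar_A: "scale c x \<in> A mu" if "x \<in> A mu" for c x mu
    using that by (rule subspace_scale[OF subspace_A])
  \<comment> \<open>This one fact yields both the independence of \<open>E\<close> over the field,
    via \<open>act 0 (f v) = 0\<close>, and the injectivity of
    \<open>x \<mapsto> act x (f v)\<close> on its span.\<close>
  have coeff: "c e = 0"
    if F: "finite F" "F \<subseteq> E" "e \<in> F" and 0: "act (\<Sum>e\<in>F. scale (c e) e) (f v) = 0" for F c e
  proof -
    let ?x = "\<Sum>e\<in>F. scale (c e) e"
    have "?x \<in> A nu"
      using F(2) basis_over_subset[OF E] by (auto intro!: subspace_sum[OF subspace_A] scalar_A)
    then have "free_action mul ?x v \<in> combinations (A nu) S"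
      using S entries A_strict_mono[OF nu] act_eq_0[OF 0]
      by (intro combinations_descend) (auto simp: free_action_def intro!: mul_A)
    moreover have "free_action mul ?x v = (\<lambda>i. \<Sum>e\<in>F. mul e (scale (c e) (v i)))"
      by (simp add: free_action_def mul_sum_left mul_scale_left mul_scale_right)
    ultimately have "(\<lambda>i. \<Sum>e\<in>F. mul e (scale (c e) (v i))) \<in> combinations (A nu) S" by simp
    \<comment> \<open>Scalars pass through \<open>mul\<close>, so the \<open>e\<close>-component is
      \<open>c e\<close> times \<open>v\<close>, with entries in \<open>A lam\<close>. It is thus a
      combination of \<open>S\<close>, and such combinations are killed by \<open>f\<close>.\<close>
    from combinations_component[where w = "\<lambda>e i. scale (c e) (v i)", OF E S _ F(1,2) _ this F(3)]
      entries scalar_A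
    have "(\<lambda>i. scale (c e) (v i)) \<in> combinations (A lam) S" by auto
    then obtain a where a: "\<And>i. scale (c e) (v i) = (\<Sum>s\<in>S. mul (a s) (s i))"
      unfolding combinations_def by blast
    have sub: "submodule (free_action mul) {v \<in> free_module n. f v = 0}"
      unfolding K[symmetric] by (rule hull_in) (simp add: submodule_def)
    have "S \<subseteq> {v \<in> free_module n. f v = 0}"
      using hull_subset[of S "submodule (free_action mul)"] K by simp
    then have "f (\<Sum>s\<in>S. free_action mul (a s) s) = 0"
      using submodule_sum[OF sub, of S a] by simp
    moreover have "(\<Sum>s\<in>S. free_action mul (a s) s) = free_action mul (scale (c e) 1) v"
      by (rule ext) (simp add: sum_apply free_action_def mul_scale_left mul_one_left a)
    ultimately have "act (scale (c e) 1) (f v) = 0" using f_act by simp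
    then show "c e = 0" using v(2) by simp
  qed
  let ?g = "\<lambda>x. act x (f v)"
  have lin: "Vector_Spaces.linear scale (\<lambda>c x. act (scale c 1) x) ?g"
    unfolding Vector_Spaces.linear_iff
  proof (intro conjI allI)
    fix c x y
    show "vector_space scale" by (rule vector_space_axioms)
    show "vector_space (\<lambda>c x. act (scale c 1) x)" by (rule M.vector_space_axioms)
    show "act (x + y) (f v) = act x (f v) + act y (f v)" by (rule act_add_left)
    have "scale c x = mul (scale c 1) x" by (simp add: mul_scale_left mul_one_left)
    then show "act (scale c x) (f v) = act (scale c 1) (act x (f v))" by (simp only: act_mul)
  qed
  have act_0: "act 0 (f v) = 0" using pair.linear_0[OF lin] .
  have indep: "independent E"
    unfolding independent_explicit_finite_subsets
  proof (intro allI impI ballI)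
    fix F c e assume F: "F \<subseteq> E" "finite F" "(\<Sum>e\<in>F. scale (c e) e) = 0" "e \<in> F"
    have "act (\<Sum>e\<in>F. scale (c e) e) (f v) = 0" unfolding F(3) by (rule act_0)
    then show "c e = 0" by (rule coeff[OF F(2,1,4)])
  qed
  have inj_span: "inj_on ?g (span E)"
    unfolding pair.linear_inj_on_iff_eq_0[OF lin subspace_span]
  proof (intro ballI impI)
    fix x assume x: "x \<in> span E" "act x (f v) = 0"
    then obtain F c where F: "finite F" "F \<subseteq> E" "x = (\<Sum>e\<in>F. scale (c e) e)"
      unfolding span_explicit by blast
    have "c e = 0" if "e \<in> F" for e
      by (rule coeff[OF F(1,2) that]) (use x(2) F(3) in simp)
    then show "x = 0" using F(3) by simp
  qed
  have ind: "M.independent (?g ` E)"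
    using pair.linear_independent_injective_image[OF lin indep inj_span] .
  have inj: "inj_on ?g E"
    using inj_span span_superset by (rule inj_on_subset)
  \<comment> \<open>The image of \<open>E\<close> is independent in a space spanned by
    \<open>T\<close>. With injectivity this also shows that \<open>E\<close>, a priori possibly
    infinite, is finite.\<close>
  have "finite (?g ` E) \<and> card (?g ` E) \<le> card T"
    using M.independent_span_bound[OF T(1) ind] T(2) by simp
  then have "finite E" "card E \<le> card T"
    using inj by (auto simp: card_image finite_image_iff)
  then have "card B \<le> card T * card T'"
    using basis_over_span_bound[OF E _ T' B(1,3)] mult_le_mono1[of "card E" "card T" "card T'"]
    by linarith
  then show False using B(2) by simp
qed

end

section \<open>Left and right modules over a locally Frobenius algebra\<close>

context locally_frobenius
begin

text \<open>For left modules the freeness used is that of \<open>A mu\<close> as a right module over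
  \<open>A lam\<close>: basis elements stand to the left of their coefficients.\<close>

lemma directed_free_algebra_left: "directed_free_algebra scale (\<lambda>a x. a * x) A"
proof
  fix lam mu :: 'l
  show "module.subspace scale (A lam)" "1 \<in> A lam"
    using subalgebra[of lam] by (auto simp: subalgebra_def)
  show "(a * x) \<in> A lam" if "a \<in> A lam" "x \<in> A lam" for a x
    using subalgebra[of lam] that by (auto simp: subalgebra_def)
  show "finite_dim scale (A lam)"
    using symmetric_frobenius[of lam] by (simp add: symmetric_frobenius_def)
  show "\<exists>mu. lam < mu"
    using no_maximal[of lam] by (auto simp: less_le)
  show "\<exists>nu. lam \<le> nu \<and> mu \<le> nu"
    by (rule directed)
  show "(\<Union>lam. A lam) = UNIV"
    by (rule A_union)
  show "A lam \<subset> A mu" if "lam < mu"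
    using proper_inclusion[of lam mu] that by auto
  show "free_over (\<lambda>b c. c * b) (A lam) (A mu)" if "lam < mu"
    using free_frobenius[of lam mu] that by (simp add: free_frobenius_extension_def)
qed (simp_all add: distrib_left distrib_right mult.assoc scale_mult_left scale_mult_right)

text \<open>Over the opposite product the sides are exchanged, and freeness as a left module over
  \<open>A lam\<close> is used.\<close>

lemma directed_free_algebra_right: "directed_free_algebra scale (\<lambda>a x. x * a) A"
proof
  fix lam mu :: 'l
  show "module.subspace scale (A lam)" "1 \<in> A lam"
    using subalgebra[of lam] by (auto simp: subalgebra_def)
  show "(x * a) \<in> A lam" if "a \<in> A lam" "x \<in> A lam" for a x
    using subalgebra[of lam] that by (auto simp: subalgebra_def)
  show "finite_dim scale (A lam)"
    using symmetric_frobenius[of lam] by (simp add: symmetric_frobenius_def)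
  show "\<exists>mu. lam < mu"
    using no_maximal[of lam] by (auto simp: less_le)
  show "\<exists>nu. lam \<le> nu \<and> mu \<le> nu"
    by (rule directed)
  show "(\<Union>lam. A lam) = UNIV"
    by (rule A_union)
  show "A lam \<subset> A mu" if "lam < mu"
    using proper_inclusion[of lam mu] that by auto
  show "free_over (\<lambda>b c. b * c) (A lam) (A mu)" if "lam < mu"
    using free_frobenius[of lam mu] that by (simp add: free_frobenius_extension_def)
qed (simp_all add: distrib_left distrib_right mult.assoc scale_mult_left scale_mult_right)

end

text \<open>The whole module is a finitely generated submodule of itself.\<close>

lemma coherent_imp_finitely_presented:
  assumes "coherent reg act UNIV"
  shows "finitely_presented reg act UNIV"
  using assms unfolding coherent_def pseudo_coherent_def by (simp add: submodule_def)

theorem proposition4p6: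
  fixes scale :: "'k::field \<Rightarrow> 'a::ring_1 \<Rightarrow> 'a"
    and lam0 :: "'l::order"
    and A :: "'l \<Rightarrow> 'a set"
    and eps :: "'l \<Rightarrow> 'a \<Rightarrow> 'k"
    and lact :: "'a \<Rightarrow> 'm::ab_group_add \<Rightarrow> 'm"
    and ract :: "'n::ab_group_add \<Rightarrow> 'a \<Rightarrow> 'n"
  assumes "locally_frobenius scale lam0 A eps"
  shows "(left_module lact \<and> (\<exists>x::'m. x \<noteq> 0) \<and>
            finite_dim (\<lambda>c x. lact (scale c 1) x) (UNIV :: 'm set)
          \<longrightarrow> \<not> left_coherent lact) \<and>
         (right_module ract \<and> (\<exists>x::'n. x \<noteq> 0) \<and>
            finite_dim (\<lambda>c x. ract x (scale c 1)) (UNIV :: 'n set)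
          \<longrightarrow> \<not> right_coherent ract)"
proof (intro conjI impI notI)
  assume L: "left_module lact \<and> (\<exists>x::'m. x \<noteq> 0) \<and>
      finite_dim (\<lambda>c x. lact (scale c 1) x) (UNIV :: 'm set)" and coh: "left_coherent lact"
  interpret locally_frobenius scale lam0 A eps by fact
  interpret directed_free_algebra scale "\<lambda>a x. a * x" A by (rule directed_free_algebra_left)
  have "\<not> finitely_presented (\<lambda>a x. a * x) lact UNIV"
    by (rule finite_dim_not_finitely_presented) (use L in \<open>auto simp: left_module_def\<close>)
  then show False
    using coh coherent_imp_finitely_presented unfolding left_coherent_def by blast
next
  assume R: "right_module ract \<and> (\<exists>x::'n. x \<noteq> 0) \<and>
      finite_dim (\<lambda>c x. ract x (scale c 1)) (UNIV :: 'n set)" and coh: "right_coherent ract"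
  interpret locally_frobenius scale lam0 A eps by fact
  interpret directed_free_algebra scale "\<lambda>a x. x * a" A by (rule directed_free_algebra_right)
  have "\<not> finitely_presented (\<lambda>a x. x * a) (\<lambda>a x. ract x a) UNIV"
    by (rule finite_dim_not_finitely_presented) (use R in \<open>auto simp: right_module_def\<close>)
  then show False
    using coh coherent_imp_finitely_presented unfolding right_coherent_def by blast
qed

end
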